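(* Let $X$ be a subset of $\mathbb{C}$. For $X$-braids $f,g\in A_X$ let $[f][g]=[f\# g]$. Then this operation on $B_X$ is well-defined, and $B_X$ becomes a group under it.
   Context: Let $\mathbb{I}=[0,1]$. For $X\subset\mathbb{C}$, $\mathbb{C}^X$ is the product space (product topology) and $F_X=\{u\in\mathbb{C}^X : u(x)\neq u(y)\text{ for all distinct }x,y\in X\}$ with the subspace topology. A path in a space is a continuous map from $\mathbb{I}$; for paths $f,g$ with $f(1)=g(0)$, $f\cdot g$ is the concatenation ($f\cdot g(t)=f(2t)$ for $t\le 1/2$, $f\cdot g(t)=g(2t-1)$ for $t\ge 1/2$); $f\sim g$ means that $f$ and $g$ are homotopic relative to $\{0,1\}$. $\Sigma_X$ is the set of all permutations of the set $X$; since $X\subset\mathbb{C}$, $\Sigma_X\subset F_X$. For a path $f$ in $F_X$ and $\sigma\in\Sigma_X$, $f^\sigma$ is the path in $F_X$ with $f^\sigma(t)(x)=f(t)(\sigma(x))$. An $X$-braid is a path $f:\mathbb{I}\to F_X$ with $f(0)=\mathrm{id}_X$ and $f(1)\in\Sigma_X$. $A_X$ is the set of $X$-braids, $[f]$ is the class of $f\in A_X$ under $\sim$, and $B_X=\{[f]:f\in A_X\}$. For $f,g\in A_X$, $f\# g=f\cdot g^{f(1)}$. *)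

theory Defs
  imports "HOL-Analysis.Analysis" "HOL-Algebra.Bij"
begin

text \<open>
  A map \<open>X \<rightarrow> \<complex>\<close> is represented by a function in \<^term>\<open>extensional X\<close>, i.e. one with the fixed value
  \<^term>\<open>undefined\<close> outside \<open>X\<close>.  The topology is the one induced from the product topology on the type
  \<^typ>\<open>complex \<Rightarrow> complex\<close>; by the lemma below this is the subspace topology from the product space
  \<open>\<complex>\<^sup>X\<close>.
\<close>

definition conf_space :: "complex set \<Rightarrow> (complex \<Rightarrow> complex) set"
  where "conf_space X = {u \<in> extensional X. inj_on u X}"

lemma top_of_set_conf_space:
  "top_of_set (conf_space X) =
     subtopology (product_topology (\<lambda>_. euclidean) X) {u. inj_on u X}"
proof -
  let ?E = "extensional X :: (complex \<Rightarrow> complex) set"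
  let ?P = "product_topology (\<lambda>_. euclidean :: complex topology) X"
  have tP: "topspace ?P = ?E"
    by (auto simp: PiE_def)
  have cont1: "continuous_map (top_of_set ?E) ?P (\<lambda>u. u)"
  proof -
    have "continuous_on ?E (\<lambda>u. u k)" for k
      by (rule continuous_on_subset [OF continuous_on_product_coordinates]) simp
    then show ?thesis
      unfolding continuous_map_componentwise by (simp add: image_subset_iff)
  qed
  have cont2: "continuous_map ?P (top_of_set ?E) (\<lambda>u. u)"
  proof -
    have "continuous_map ?P euclidean (\<lambda>u. u k)" for k
    proof (cases "k \<in> X")
      case True
      then show ?thesis by (rule continuous_map_product_projection)
    next
      case False
      have "continuous_map ?P euclidean (\<lambda>_. undefined :: complex)"
        by simp
      moreover have "undefined = u k" if "u \<in> topspace ?P" for u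
        using False that unfolding tP by (metis extensional_arb)
      ultimately show ?thesis
        by (rule continuous_map_eq)
    qed
    then have "continuous_map ?P (product_topology (\<lambda>_. euclidean) UNIV) (\<lambda>u. u)"
      by (simp add: continuous_map_componentwise_UNIV)
    then show ?thesis
      unfolding euclidean_product_topology continuous_map_in_subtopology tP by simp
  qed
  have op: "openin S U" if "continuous_map S T (\<lambda>u. u)" "topspace S = topspace T" "openin T U"
    for S T :: "(complex \<Rightarrow> complex) topology" and U
  proof -
    have "{u \<in> topspace S. u \<in> U} = U"
      using openin_subset [OF that(3)] that(2) by auto
    then show ?thesis
      using openin_continuous_map_preimage [OF that(1,3)] by simp
  qed
  have "topspace ?P = topspace (top_of_set ?E)"
    using tP by simp
  then have "openin (top_of_set ?E) U \<longleftrightarrow> openin ?P U" for U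
    using op [OF cont1, of U] op [OF cont2, of U] by argo
  then have "top_of_set ?E = ?P"
    by (simp only: topology_eq simp_thms)
  moreover have "conf_space X = ?E \<inter> {u. inj_on u X}"
    by (auto simp: conf_space_def)
  ultimately show ?thesis
    using subtopology_subtopology [of euclidean ?E "{u. inj_on u X}"] by simp
qed

text \<open>
  The permutations of \<open>X\<close> are the elements of \<^term>\<open>Bij X\<close>, and the identity of \<open>X\<close> is \<open>\<lambda>x\<in>X. x\<close>.
  As usual for \<^const>\<open>path\<close> and \<^const>\<open>homotopic_paths\<close>, paths are total functions on \<^typ>\<open>real\<close> whose
  values outside \<open>{0..1}\<close> are irrelevant: paths that agree on \<open>{0..1}\<close> are homotopic, so they
  lie in the same class.
\<close>

definition braids :: "complex set \<Rightarrow> (real \<Rightarrow> complex \<Rightarrow> complex) set"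
  where "braids X =
    {f. path f \<and> path_image f \<subseteq> conf_space X \<and> pathstart f = (\<lambda>x\<in>X. x) \<and> pathfinish f \<in> Bij X}"

definition perm_path ::
    "complex set \<Rightarrow> (real \<Rightarrow> complex \<Rightarrow> complex) \<Rightarrow> (complex \<Rightarrow> complex) \<Rightarrow> real \<Rightarrow> complex \<Rightarrow> complex"
  where "perm_path X f \<sigma> = (\<lambda>t. \<lambda>x\<in>X. f t (\<sigma> x))"

definition braid_comp ::
    "complex set \<Rightarrow> (real \<Rightarrow> complex \<Rightarrow> complex) \<Rightarrow> (real \<Rightarrow> complex \<Rightarrow> complex) \<Rightarrow> real \<Rightarrow> complex \<Rightarrow> complex"
  where "braid_comp X f g = f +++ perm_path X g (pathfinish f)"

definition braid_class ::
    "complex set \<Rightarrow> (real \<Rightarrow> complex \<Rightarrow> complex) \<Rightarrow> (real \<Rightarrow> complex \<Rightarrow> complex) set"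
  where "braid_class X f = {g \<in> braids X. homotopic_paths (conf_space X) f g}"

definition braid_classes :: "complex set \<Rightarrow> (real \<Rightarrow> complex \<Rightarrow> complex) set set"
  where "braid_classes X = braid_class X ` braids X"

text \<open>
  The description below determines the product only if the class of \<^term>\<open>braid_comp X f g\<close> does not
  depend on the representatives \<open>f\<close> and \<open>g\<close>.
\<close>

definition braid_mult ::
    "complex set \<Rightarrow> (real \<Rightarrow> complex \<Rightarrow> complex) set \<Rightarrow> (real \<Rightarrow> complex \<Rightarrow> complex) set
      \<Rightarrow> (real \<Rightarrow> complex \<Rightarrow> complex) set"
  where "braid_mult X P Q = (THE R. \<exists>f\<in>P. \<exists>g\<in>Q. R = braid_class X (braid_comp X f g))"

definition braid_group :: "complex set \<Rightarrow> (real \<Rightarrow> complex \<Rightarrow> complex) set monoid"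
  where "braid_group X =
    \<lparr>carrier = braid_classes X, mult = braid_mult X, one = braid_class X (\<lambda>t. \<lambda>x\<in>X. x)\<rparr>"

end

theory Submission
  imports Defs
begin

text \<open>
  A permutation \<open>\<sigma>\<close> acts on the configuration space by precomposition \<open>u \<mapsto> u \<circ> \<sigma>\<close>.  This is a right
  action by continuous maps, and \<open>perm_path X f \<sigma>\<close> is the image of the path \<open>f\<close> under it.  A braid
  \<open>g\<close> starts at the identity, so its translate by \<open>f(1)\<close> starts where \<open>f\<close> ends, and the
  product of braids is an ordinary concatenation of paths.  The group laws are therefore the groupoid
  laws for homotopy classes of paths, transported by the action.

  The product respects homotopy because concatenation does, because continuous maps carry
  homotopies to homotopies (\<open>homotopic_paths_perm_path\<close>), and because homotopic braids end at the
  same permutation, so that they translate the second factor in the same way.  Associativity is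
  that of concatenation together with the action law \<open>(u \<circ> \<tau>) \<circ> \<sigma> = u \<circ> (\<tau> \<circ> \<sigma>)\<close>.  The inverse of a
  braid \<open>f\<close> ending at \<open>\<sigma>\<close> is the translate of \<open>f\<close> by \<open>\<sigma>\<inverse>\<close> run backwards: that translate leads
  from \<open>\<sigma>\<inverse>\<close> to the identity, so its reverse is a braid ending at \<open>\<sigma>\<inverse>\<close>, and multiplying
  it by \<open>f\<close> retraces the path.
\<close>

section \<open>Constant paths and reversed paths in a topological space\<close>

text \<open>
  With the constant path written as a degenerate \<^const>\<open>linepath\<close>, the unit and inverse laws for
  concatenation are statements about normed vector spaces, and \<open>\<complex>\<^sup>X\<close> is not normable for infinite
  \<open>X\<close>.  But every path is the image under a continuous map, namely itself, of the identity
  path of \<open>{0..1}\<close>, so the laws in the real line imply them in any space.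
\<close>

lemma homotopic_paths_const_left:
  fixes p :: "real \<Rightarrow> 'a::topological_space"
  assumes "path p" "path_image p \<subseteq> S"
  shows "homotopic_paths S ((\<lambda>_. pathstart p) +++ p) p"
proof -
  have "homotopic_paths {0..1} (linepath 0 0 +++ (\<lambda>t. t)) (\<lambda>t::real. t)"
    by (rule homotopic_paths_lid') (auto simp: path_def path_image_def pathstart_def)
  then have "homotopic_paths S (p \<circ> (linepath 0 0 +++ (\<lambda>t. t))) (p \<circ> (\<lambda>t. t))"
    using assms
    by (intro homotopic_paths_continuous_image) (auto simp: path_def path_image_def)
  moreover have "p \<circ> linepath 0 0 = (\<lambda>_. pathstart p)"
    by (auto simp: pathstart_def linepath_def)
  ultimately show ?thesis
    by (simp add: path_compose_join) (simp add: o_def)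
qed

lemma homotopic_paths_reversepath_const:
  fixes p :: "real \<Rightarrow> 'a::topological_space"
  assumes "path p" "path_image p \<subseteq> S"
  shows "homotopic_paths S (reversepath p +++ p) (\<lambda>_. pathfinish p)"
proof -
  have "homotopic_paths {0..1} (reversepath (\<lambda>t. t) +++ (\<lambda>t. t)) (linepath 1 (1::real))"
    using homotopic_paths_linv [of "\<lambda>t::real. t" "{0..1}"]
    by (auto simp: path_def path_image_def pathfinish_def)
  then have "homotopic_paths S (p \<circ> (reversepath (\<lambda>t. t) +++ (\<lambda>t. t))) (p \<circ> linepath 1 1)"
    using assms
    by (intro homotopic_paths_continuous_image) (auto simp: path_def path_image_def)
  moreover have "p \<circ> linepath 1 1 = (\<lambda>_. pathfinish p)"
    by (auto simp: pathfinish_def linepath_def)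
  ultimately show ?thesis
    by (simp add: path_compose_join path_compose_reversepath) (simp add: o_def)
qed

section \<open>The action of permutations on paths of configurations\<close>

lemma perm_path_eq_compose: "perm_path X f \<sigma> = (\<lambda>u. compose X u \<sigma>) \<circ> f"
  by (simp add: perm_path_def compose_def o_def)

text \<open>
  Each coordinate of \<open>u \<circ> \<sigma>\<close> is either a coordinate of \<open>u\<close> or the constant
  default value outside \<open>X\<close>.
\<close>

lemma continuous_on_compose_right:
  fixes S :: "('b \<Rightarrow> 'c::topological_space) set"
  shows "continuous_on S (\<lambda>u. compose X u \<sigma>)"
proof (rule continuous_on_coordinatewise_then_product)
  fix x
  show "continuous_on S (\<lambda>u. compose X u \<sigma> x)"
    by (cases "x \<in> X")
      (auto simp: compose_def intro: continuous_on_product_then_coordinatewise continuous_on_id)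
qed

lemma compose_in_conf_space:
  assumes "u \<in> conf_space X" "\<sigma> \<in> Bij X"
  shows "compose X u \<sigma> \<in> conf_space X"
  using assms comp_inj_on [of \<sigma> X u]
  by (auto simp: conf_space_def Bij_def bij_betw_def compose_def inj_on_def)

lemma Bij_subset_conf_space: "Bij X \<subseteq> conf_space X"
  by (auto simp: conf_space_def Bij_def bij_betw_def)

lemma perm_path_in_conf_space:
  assumes "path f" "path_image f \<subseteq> conf_space X" "\<sigma> \<in> Bij X"
  shows "path (perm_path X f \<sigma>)" "path_image (perm_path X f \<sigma>) \<subseteq> conf_space X"
  using assms compose_in_conf_space
  by (auto simp: perm_path_eq_compose path_image_compose
      intro!: path_continuous_image continuous_on_compose_right)

lemma perm_path_ends [simp]:
  "pathstart (perm_path X f \<sigma>) = compose X (pathstart f) \<sigma>"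
  "pathfinish (perm_path X f \<sigma>) = compose X (pathfinish f) \<sigma>"
  by (simp_all add: perm_path_eq_compose pathstart_compose pathfinish_compose)

lemma homotopic_paths_perm_path:
  assumes "homotopic_paths (conf_space X) f g" "\<sigma> \<in> Bij X"
  shows "homotopic_paths (conf_space X) (perm_path X f \<sigma>) (perm_path X g \<sigma>)"
  unfolding perm_path_eq_compose
  using assms compose_in_conf_space
  by (intro homotopic_paths_continuous_image continuous_on_compose_right) auto

lemma perm_path_join: "perm_path X (f +++ g) \<sigma> = perm_path X f \<sigma> +++ perm_path X g \<sigma>"
  by (simp add: perm_path_eq_compose path_compose_join)

lemma perm_path_perm_path:
  assumes "\<sigma> \<in> Bij X"
  shows "perm_path X (perm_path X f \<tau>) \<sigma> = perm_path X f (compose X \<tau> \<sigma>)"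
  using Bij_imp_funcset [OF assms] by (fastforce simp: perm_path_def compose_def fun_eq_iff)

text \<open>
  Only a homotopy, not an equation: outside \<open>{0..1}\<close> the values of a path need not be
  extensional functions.
\<close>

lemma homotopic_paths_perm_path_id:
  assumes "path f" "path_image f \<subseteq> conf_space X"
  shows "homotopic_paths (conf_space X) f (perm_path X f (\<lambda>x\<in>X. x))"
proof (rule homotopic_paths_eq [OF assms])
  fix t :: real
  assume "t \<in> {0..1}"
  then have "f t \<in> extensional X"
    using assms(2) unfolding path_image_def conf_space_def by blast
  then show "f t = perm_path X f (\<lambda>x\<in>X. x) t"
    by (simp add: perm_path_def extensional_def fun_eq_iff)
qed

section \<open>Products of braids\<close>

lemma braidsD:
  assumes "f \<in> braids X"
  shows "path f" "path_image f \<subseteq> conf_space X" "pathstart f = (\<lambda>x\<in>X. x)" "pathfinish f \<in> Bij X"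
  using assms by (auto simp: braids_def)

lemma const_in_braids: "(\<lambda>_. \<lambda>x\<in>X. x) \<in> braids X"
  using id_Bij [of X] Bij_subset_conf_space [of X]
  by (auto simp: braids_def path_def path_image_def pathstart_def pathfinish_def)

lemma compose_id_Bij: "\<sigma> \<in> Bij X \<Longrightarrow> compose X (\<lambda>x\<in>X. x) \<sigma> = \<sigma>"
  by (simp add: Id_compose Bij_imp_funcset Bij_imp_extensional)

lemma pathstart_perm_path_braid:
  assumes "g \<in> braids X" "\<sigma> \<in> Bij X"
  shows "pathstart (perm_path X g \<sigma>) = \<sigma>"
  using assms by (simp add: braidsD compose_id_Bij)

lemma pathfinish_braid_comp:
  "pathfinish (braid_comp X f g) = compose X (pathfinish g) (pathfinish f)"
  by (simp add: braid_comp_def)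

lemma braid_comp_in_braids:
  assumes "f \<in> braids X" "g \<in> braids X"
  shows "braid_comp X f g \<in> braids X"
proof -
  note f = braidsD [OF assms(1)] and g = braidsD [OF assms(2)]
  note pg = perm_path_in_conf_space [OF g(1,2) f(4)]
  have "path (braid_comp X f g)"
    using f pg pathstart_perm_path_braid [OF assms(2) f(4)]
    unfolding braid_comp_def by (intro path_join_imp) auto
  moreover have "path_image (braid_comp X f g) \<subseteq> conf_space X"
    unfolding braid_comp_def using f pg by (intro subset_path_image_join)
  moreover have "pathfinish (braid_comp X f g) \<in> Bij X"
    using f g by (simp add: pathfinish_braid_comp compose_Bij)
  ultimately show ?thesis
    using f by (simp add: braids_def) (simp add: braid_comp_def)
qed

text \<open>
  Homotopies are relative to the endpoints, so \<open>f\<close> and \<open>f'\<close> end at the same permutation, and it is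
  one and the same continuous map that translates \<open>g\<close> and \<open>g'\<close>.
\<close>

lemma homotopic_paths_braid_comp:
  assumes "f \<in> braids X" "g \<in> braids X"
    and ff': "homotopic_paths (conf_space X) f f'" and gg': "homotopic_paths (conf_space X) g g'"
  shows "homotopic_paths (conf_space X) (braid_comp X f g) (braid_comp X f' g')"
proof -
  have "pathfinish f' = pathfinish f"
    using homotopic_paths_imp_pathfinish [OF ff'] by simp
  moreover have "pathfinish f = pathstart (perm_path X g (pathfinish f))"
    using assms by (simp only: pathstart_perm_path_braid braidsD)
  ultimately show ?thesis
    unfolding braid_comp_def
    using ff' homotopic_paths_perm_path [OF gg'] braidsD [OF assms(1)]
    by (simp add: homotopic_paths_join)
qed

text \<open>
  For braids \<open>f\<close> and \<open>g\<close> ending at \<open>\<sigma>\<close> and \<open>\<tau>\<close>, both bracketings concatenate the same three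
  paths, namely \<open>f\<close>, the translate of \<open>g\<close> by \<open>\<sigma>\<close>, and the translate of \<open>h\<close> by \<open>\<tau> \<circ> \<sigma>\<close>: the endpoint of
  \<open>f # g\<close> is \<open>\<tau> \<circ> \<sigma>\<close>, and translating by \<open>\<tau>\<close> and then by \<open>\<sigma>\<close> has the same effect.
\<close>

lemma braid_comp_assoc:
  assumes "f \<in> braids X" "g \<in> braids X" "h \<in> braids X"
  shows "homotopic_paths (conf_space X)
    (braid_comp X (braid_comp X f g) h) (braid_comp X f (braid_comp X g h))"
proof -
  let ?\<sigma> = "pathfinish f" and ?\<tau> = "pathfinish g"
  note f = braidsD [OF assms(1)] and g = braidsD [OF assms(2)] and h = braidsD [OF assms(3)]
  have \<tau>\<sigma>: "compose X ?\<tau> ?\<sigma> \<in> Bij X"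
    using f g by (simp add: compose_Bij)
  note pg = perm_path_in_conf_space [OF g(1,2) f(4)]
  note ph = perm_path_in_conf_space [OF h(1,2) \<tau>\<sigma>]
  have "homotopic_paths (conf_space X)
      (f +++ (perm_path X g ?\<sigma> +++ perm_path X h (compose X ?\<tau> ?\<sigma>)))
      ((f +++ perm_path X g ?\<sigma>) +++ perm_path X h (compose X ?\<tau> ?\<sigma>))"
    using f pg ph pathstart_perm_path_braid [OF assms(2) f(4)]
      pathstart_perm_path_braid [OF assms(3) \<tau>\<sigma>]
    by (intro homotopic_paths_assoc) simp_all
  moreover have "braid_comp X f (braid_comp X g h) =
      f +++ (perm_path X g ?\<sigma> +++ perm_path X h (compose X ?\<tau> ?\<sigma>))"
    using f by (simp add: braid_comp_def perm_path_join perm_path_perm_path)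
  moreover have "braid_comp X (braid_comp X f g) h =
      (f +++ perm_path X g ?\<sigma>) +++ perm_path X h (compose X ?\<tau> ?\<sigma>)"
    by (simp add: braid_comp_def)
  ultimately show ?thesis
    by (simp add: homotopic_paths_sym)
qed

lemma braid_comp_const_left:
  assumes "f \<in> braids X"
  shows "homotopic_paths (conf_space X) (braid_comp X (\<lambda>_. \<lambda>x\<in>X. x) f) f"
proof -
  let ?c = "\<lambda>_::real. \<lambda>x\<in>X. x"
  note f = braidsD [OF assms]
  have "homotopic_paths (conf_space X) (?c +++ perm_path X f (\<lambda>x\<in>X. x)) (?c +++ f)"
    using f braidsD(1,2) [OF const_in_braids [of X]] homotopic_paths_perm_path_id [OF f(1,2)]
      pathstart_perm_path_braid [OF assms id_Bij]
    by (intro homotopic_paths_join) (auto simp: homotopic_paths_sym pathfinish_def)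
  also have "homotopic_paths (conf_space X) (?c +++ f) f"
    using homotopic_paths_const_left [OF f(1,2)] f(3) by simp
  finally show ?thesis
    by (simp add: braid_comp_def pathfinish_def)
qed

definition braid_inverse :: "complex set \<Rightarrow> (real \<Rightarrow> complex \<Rightarrow> complex) \<Rightarrow> real \<Rightarrow> complex \<Rightarrow> complex"
  where "braid_inverse X f =
    reversepath (perm_path X f (\<lambda>x\<in>X. inv_into X (pathfinish f) x))"

lemma compose_Bij_inv_into:
  "\<sigma> \<in> Bij X \<Longrightarrow> compose X \<sigma> (\<lambda>x\<in>X. inv_into X \<sigma> x) = (\<lambda>x\<in>X. x)"
  by (auto simp: Bij_def bij_betw_def compose_def fun_eq_iff f_inv_into_f)

lemma braid_inverse_in_braids:
  assumes "f \<in> braids X"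
  shows "braid_inverse X f \<in> braids X"
proof -
  note f = braidsD [OF assms]
  note inv = restrict_inv_into_Bij [OF f(4)]
  show ?thesis
    using f inv perm_path_in_conf_space [OF f(1,2) inv] pathstart_perm_path_braid [OF assms inv]
    by (simp add: braids_def braid_inverse_def compose_Bij_inv_into)
qed

text \<open>
  The inverse of \<open>f\<close> ends at \<open>\<sigma>\<inverse>\<close>, so the product translates \<open>f\<close> by the very permutation used to
  construct the inverse, and it has the form \<open>reversepath p +++ p\<close>.
\<close>

lemma braid_comp_inverse_left:
  assumes "f \<in> braids X"
  shows "homotopic_paths (conf_space X) (braid_comp X (braid_inverse X f) f) (\<lambda>_. \<lambda>x\<in>X. x)"
proof -
  note f = braidsD [OF assms]
  let ?\<sigma>' = "\<lambda>x\<in>X. inv_into X (pathfinish f) x"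
  let ?p = "perm_path X f ?\<sigma>'"
  note inv = restrict_inv_into_Bij [OF f(4)]
  have "pathfinish (braid_inverse X f) = ?\<sigma>'"
    using pathstart_perm_path_braid [OF assms inv] by (simp add: braid_inverse_def)
  then have "braid_comp X (braid_inverse X f) f = reversepath ?p +++ ?p"
    by (simp add: braid_comp_def) (simp add: braid_inverse_def)
  moreover have "pathfinish ?p = (\<lambda>x\<in>X. x)"
    using f by (simp add: compose_Bij_inv_into)
  ultimately show ?thesis
    using homotopic_paths_reversepath_const [OF perm_path_in_conf_space [OF f(1,2) inv]] by simp
qed

section \<open>The group of braid classes\<close>

lemma braid_class_eq_iff:
  assumes "f \<in> braids X" "g \<in> braids X"
  shows "braid_class X f = braid_class X g \<longleftrightarrow> homotopic_paths (conf_space X) f g"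
proof
  assume "braid_class X f = braid_class X g"
  moreover have "g \<in> braid_class X g"
    using assms by (simp add: braid_class_def braidsD)
  ultimately show "homotopic_paths (conf_space X) f g"
    by (auto simp: braid_class_def)
next
  assume "homotopic_paths (conf_space X) f g"
  then show "braid_class X f = braid_class X g"
    unfolding braid_class_def by (blast intro: homotopic_paths_trans homotopic_paths_sym)
qed

lemma braid_class_comp_cong:
  assumes "f \<in> braids X" "f' \<in> braids X" "g \<in> braids X" "g' \<in> braids X"
    and "braid_class X f = braid_class X f'" "braid_class X g = braid_class X g'"
  shows "braid_class X (braid_comp X f g) = braid_class X (braid_comp X f' g')"
  using assms by (simp add: braid_class_eq_iff braid_comp_in_braids homotopic_paths_braid_comp)

text \<open>
  The independence of representatives is what makes the definite description in the definition
  of the product denote this class.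
\<close>

lemma braid_mult_class:
  assumes "f \<in> braids X" "g \<in> braids X"
  shows "braid_mult X (braid_class X f) (braid_class X g) = braid_class X (braid_comp X f g)"
  unfolding braid_mult_def
proof (rule the_equality)
  show "\<exists>f'\<in>braid_class X f. \<exists>g'\<in>braid_class X g.
      braid_class X (braid_comp X f g) = braid_class X (braid_comp X f' g')"
  proof (intro bexI)
    show "braid_class X (braid_comp X f g) = braid_class X (braid_comp X f g)" ..
    show "f \<in> braid_class X f" "g \<in> braid_class X g"
      using assms by (simp_all add: braid_class_def braidsD)
  qed
next
  fix R
  assume "\<exists>f'\<in>braid_class X f. \<exists>g'\<in>braid_class X g. R = braid_class X (braid_comp X f' g')"
  then obtain f' g' where f': "f' \<in> braid_class X f" and g': "g' \<in> braid_class X g"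
    and R: "R = braid_class X (braid_comp X f' g')"
    by blast
  have "f' \<in> braids X" "g' \<in> braids X"
    "homotopic_paths (conf_space X) f f'" "homotopic_paths (conf_space X) g g'"
    using f' g' by (auto simp: braid_class_def)
  then show "R = braid_class X (braid_comp X f g)"
    using assms braid_class_comp_cong [of f X f' g g'] unfolding R by (simp add: braid_class_eq_iff)
qed

lemma group_braid_group: "group (braid_group X)"
proof (rule groupI)
  show "\<one>\<^bsub>braid_group X\<^esub> \<in> carrier (braid_group X)"
    by (simp add: braid_group_def braid_classes_def const_in_braids)
next
  fix P Q
  assume "P \<in> carrier (braid_group X)" "Q \<in> carrier (braid_group X)"
  then show "P \<otimes>\<^bsub>braid_group X\<^esub> Q \<in> carrier (braid_group X)"
    by (auto simp: braid_group_def braid_classes_def braid_mult_class braid_comp_in_braids)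
next
  fix P Q R
  assume "P \<in> carrier (braid_group X)" "Q \<in> carrier (braid_group X)" "R \<in> carrier (braid_group X)"
  then obtain f g h where "f \<in> braids X" "g \<in> braids X" "h \<in> braids X"
    "P = braid_class X f" "Q = braid_class X g" "R = braid_class X h"
    by (auto simp: braid_group_def braid_classes_def)
  then show "(P \<otimes>\<^bsub>braid_group X\<^esub> Q) \<otimes>\<^bsub>braid_group X\<^esub> R =
      P \<otimes>\<^bsub>braid_group X\<^esub> (Q \<otimes>\<^bsub>braid_group X\<^esub> R)"
    by (simp add: braid_group_def braid_mult_class braid_comp_in_braids
        braid_class_eq_iff braid_comp_assoc)
next
  fix P
  assume "P \<in> carrier (braid_group X)"
  then obtain f where f: "f \<in> braids X" "P = braid_class X f"
    by (auto simp: braid_group_def braid_classes_def)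
  then show "\<one>\<^bsub>braid_group X\<^esub> \<otimes>\<^bsub>braid_group X\<^esub> P = P"
    by (simp add: braid_group_def braid_mult_class braid_class_eq_iff braid_comp_in_braids
        const_in_braids braid_comp_const_left)
  have "braid_class X (braid_inverse X f) \<otimes>\<^bsub>braid_group X\<^esub> P = \<one>\<^bsub>braid_group X\<^esub>"
    using f by (simp add: braid_group_def braid_mult_class braid_class_eq_iff braid_comp_in_braids
        const_in_braids braid_inverse_in_braids braid_comp_inverse_left)
  moreover have "braid_class X (braid_inverse X f) \<in> carrier (braid_group X)"
    using f by (simp add: braid_group_def braid_classes_def braid_inverse_in_braids)
  ultimately show "\<exists>Q\<in>carrier (braid_group X). Q \<otimes>\<^bsub>braid_group X\<^esub> P = \<one>\<^bsub>braid_group X\<^esub>"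
    by blast
qed

theorem proposition1p2:
  fixes X :: "complex set"
  shows "(\<forall>f\<in>braids X. \<forall>g\<in>braids X. braid_comp X f g \<in> braids X) \<and>
    (\<forall>f\<in>braids X. \<forall>f'\<in>braids X. \<forall>g\<in>braids X. \<forall>g'\<in>braids X.
        braid_class X f = braid_class X f' \<longrightarrow> braid_class X g = braid_class X g' \<longrightarrow>
        braid_class X (braid_comp X f g) = braid_class X (braid_comp X f' g')) \<and>
    (\<forall>f\<in>braids X. \<forall>g\<in>braids X.
        braid_class X f \<otimes>\<^bsub>braid_group X\<^esub> braid_class X g = braid_class X (braid_comp X f g)) \<and>
    group (braid_group X)"
proof (intro conjI ballI impI)
  show "group (braid_group X)"
    by (rule group_braid_group)
  show "braid_comp X f g \<in> braids X" if "f \<in> braids X" "g \<in> braids X" for f g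
    using that by (rule braid_comp_in_braids)
  show "braid_class X f \<otimes>\<^bsub>braid_group X\<^esub> braid_class X g = braid_class X (braid_comp X f g)"
    if "f \<in> braids X" "g \<in> braids X" for f g
    using that by (simp add: braid_group_def braid_mult_class)
qed (rule braid_class_comp_cong)

end
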